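(* Let $n, h \ge 1$ and $p \ge 1$ be integers, $\delta$ a real with $0\le\delta < 1/6$, $\mathcal{Z}$ a set, $f:\{0,1\}^p\to\mathcal{Z}$, and $g:\{0,1\}^n\times\{0,1\}^n\to\{0,1\}$ a (possibly partial) function. If $g$ has $(\delta,h)$-hitting monochromatic rectangle-distributions and $p \le 2^{h/2}$, then $$\mathcal{D}^{dt}(f) \le \frac{8}{h}\cdot \mathcal{D}^{cc}(f\circ g^p).$$
   Context: A rectangle $U\times V\subseteq \{0,1\}^n\times\{0,1\}^n$ is $c$-monochromatic (for $c\in\{0,1\}$) if $g(u,v)$ is defined and equals $c$ for all $(u,v)\in U\times V$. A distribution $\sigma$ over rectangles in $\{0,1\}^n\times\{0,1\}^n$ is a $(\delta,h)$-hitting rectangle-distribution if for every $X,Y\subseteq\{0,1\}^n$ with $|X|/2^n\ge 2^{-h}$ and $|Y|/2^n\ge 2^{-h}$, $\Pr_{R\sim\sigma}[R\cap(X\times Y)\ne\emptyset]\ge 1-\delta$. $g$ has $(\delta,h)$-hitting monochromatic rectangle-distributions if there are two $(\delta,h)$-hitting rectangle-distributions $\sigma_0,\sigma_1$ such that $\sigma_c$ is supported on $c$-monochromatic rectangles. $f\circ g^p(x,y)=f(g(x_1,y_1),\dots,g(x_p,y_p))$, defined when all $g(x_i,y_i)$ are defined. $\mathcal{D}^{cc}(F)$ is the minimum depth of a deterministic two-party protocol (Alice holds $x$, Bob holds $y$) computing $F$ correctly on its whole domain; $\mathcal{D}^{dt}(f)$ is the minimum depth of a deterministic decision tree computing $f$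 by querying input bits. *)

theory Defs
  imports "HOL-Probability.Probability"
begin

definition cube :: "nat \<Rightarrow> bool list set" where
  "cube n = {u. length u = n}"

definition blocks :: "nat \<Rightarrow> nat \<Rightarrow> bool list list set" where
  "blocks p n = {x. length x = p \<and> set x \<subseteq> cube n}"

text \<open>Partial functions on \<open>{0,1}\<^sup>n \<times> {0,1}\<^sup>n\<close> are option-valued, \<open>None\<close> meaning undefined;
  values outside \<open>cube n\<close> are irrelevant.\<close>

definition rectangle :: "nat \<Rightarrow> (bool list \<times> bool list) set \<Rightarrow> bool" where
  "rectangle n R \<longleftrightarrow> (\<exists>U V. U \<subseteq> cube n \<and> V \<subseteq> cube n \<and> R = U \<times> V)"

definition monochromatic ::
  "(bool list \<Rightarrow> bool list \<Rightarrow> bool option) \<Rightarrow> bool \<Rightarrow> (bool list \<times> bool list) set \<Rightarrow> bool" where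
  "monochromatic g c R \<longleftrightarrow> (\<forall>(u, v) \<in> R. g u v = Some c)"

text \<open>There are only finitely many rectangles for a given \<open>n\<close>, so every distribution over them is
  a probability mass function.\<close>

definition hitting_rectangle_distribution ::
  "nat \<Rightarrow> real \<Rightarrow> nat \<Rightarrow> (bool list \<times> bool list) set pmf \<Rightarrow> bool" where
  "hitting_rectangle_distribution n \<delta> h \<sigma> \<longleftrightarrow>
     (\<forall>R \<in> set_pmf \<sigma>. rectangle n R) \<and>
     (\<forall>X Y. X \<subseteq> cube n \<longrightarrow> Y \<subseteq> cube n \<longrightarrow>
        real (card X) / 2 ^ n \<ge> 2 powr (- real h) \<longrightarrow>
        real (card Y) / 2 ^ n \<ge> 2 powr (- real h) \<longrightarrow>
        measure_pmf.prob \<sigma> {R. R \<inter> (X \<times> Y) \<noteq> {}} \<ge> 1 - \<delta>)"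

definition has_hitting_monochromatic_distributions ::
  "nat \<Rightarrow> real \<Rightarrow> nat \<Rightarrow> (bool list \<Rightarrow> bool list \<Rightarrow> bool option) \<Rightarrow> bool" where
  "has_hitting_monochromatic_distributions n \<delta> h g \<longleftrightarrow>
     (\<exists>\<sigma>0 \<sigma>1. hitting_rectangle_distribution n \<delta> h \<sigma>0 \<and>
              hitting_rectangle_distribution n \<delta> h \<sigma>1 \<and>
              (\<forall>R \<in> set_pmf \<sigma>0. monochromatic g False R) \<and>
              (\<forall>R \<in> set_pmf \<sigma>1. monochromatic g True R))"

definition block_compose ::
  "(bool list \<Rightarrow> 'z) \<Rightarrow> (bool list \<Rightarrow> bool list \<Rightarrow> bool option) \<Rightarrow> nat \<Rightarrow>
   bool list list \<Rightarrow> bool list list \<Rightarrow> 'z option" where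
  "block_compose f g p x y =
     (if \<forall>i<p. g (x ! i) (y ! i) \<noteq> None
      then Some (f (map (\<lambda>i. the (g (x ! i) (y ! i))) [0..<p]))
      else None)"

text \<open>In both kinds of trees below, the first subtree is followed on bit \<open>0\<close> (\<open>False\<close>) and the
  second one on bit \<open>1\<close> (\<open>True\<close>).\<close>

datatype 'z dtree = DLeaf 'z | Query nat "'z dtree" "'z dtree"

fun dt_queries :: "'z dtree \<Rightarrow> nat set" where
  "dt_queries (DLeaf z) = {}"
| "dt_queries (Query i t0 t1) = insert i (dt_queries t0 \<union> dt_queries t1)"

fun dt_eval :: "'z dtree \<Rightarrow> bool list \<Rightarrow> 'z" where
  "dt_eval (DLeaf z) w = z"
| "dt_eval (Query i t0 t1) w = (if w ! i then dt_eval t1 w else dt_eval t0 w)"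

fun dt_depth :: "'z dtree \<Rightarrow> nat" where
  "dt_depth (DLeaf z) = 0"
| "dt_depth (Query i t0 t1) = Suc (max (dt_depth t0) (dt_depth t1))"

definition dt_computes :: "nat \<Rightarrow> 'z dtree \<Rightarrow> (bool list \<Rightarrow> 'z) \<Rightarrow> bool" where
  "dt_computes p t f \<longleftrightarrow> dt_queries t \<subseteq> {..<p} \<and> (\<forall>w \<in> cube p. dt_eval t w = f w)"

definition dt_complexity :: "nat \<Rightarrow> (bool list \<Rightarrow> 'z) \<Rightarrow> nat" where
  "dt_complexity p f = (LEAST d. \<exists>t. dt_computes p t f \<and> dt_depth t = d)"

datatype ('a, 'b, 'z) protocol =
    Output 'z
  | Alice "'a \<Rightarrow> bool" "('a, 'b, 'z) protocol" "('a, 'b, 'z) protocol"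
  | Bob "'b \<Rightarrow> bool" "('a, 'b, 'z) protocol" "('a, 'b, 'z) protocol"

fun run_protocol :: "('a, 'b, 'z) protocol \<Rightarrow> 'a \<Rightarrow> 'b \<Rightarrow> 'z" where
  "run_protocol (Output z) x y = z"
| "run_protocol (Alice a P0 P1) x y = (if a x then run_protocol P1 x y else run_protocol P0 x y)"
| "run_protocol (Bob b P0 P1) x y = (if b y then run_protocol P1 x y else run_protocol P0 x y)"

fun protocol_depth :: "('a, 'b, 'z) protocol \<Rightarrow> nat" where
  "protocol_depth (Output z) = 0"
| "protocol_depth (Alice a P0 P1) = Suc (max (protocol_depth P0) (protocol_depth P1))"
| "protocol_depth (Bob b P0 P1) = Suc (max (protocol_depth P0) (protocol_depth P1))"

definition protocol_computes ::
  "'a set \<Rightarrow> 'b set \<Rightarrow> ('a, 'b, 'z) protocol \<Rightarrow> ('a \<Rightarrow> 'b \<Rightarrow> 'z option) \<Rightarrow> bool" where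
  "protocol_computes A B P F \<longleftrightarrow>
     (\<forall>x \<in> A. \<forall>y \<in> B. \<forall>z. F x y = Some z \<longrightarrow> run_protocol P x y = z)"

definition cc_complexity :: "'a set \<Rightarrow> 'b set \<Rightarrow> ('a \<Rightarrow> 'b \<Rightarrow> 'z option) \<Rightarrow> nat" where
  "cc_complexity A B F = (LEAST d. \<exists>P. protocol_computes A B P F \<and> protocol_depth P = d)"

text \<open>The two minima are attained, so the uses of \<open>LEAST\<close> above are meaningful.\<close>

lemma ex_dtree: "\<exists>t. dt_computes p t f"
proof -
  have "\<exists>t. dt_queries t \<subseteq> {..<p} \<and> (\<forall>w \<in> cube p. dt_eval t w = k (drop (p - m) w))"
    if "m \<le> p" for m and k :: "bool list \<Rightarrow> 'a"
    using that
  proof (induction m arbitrary: k)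
    case 0
    show ?case by (rule exI[of _ "DLeaf (k [])"]) (simp add: cube_def)
  next
    case (Suc m)
    obtain t0 where t0: "dt_queries t0 \<subseteq> {..<p}"
      "\<forall>w \<in> cube p. dt_eval t0 w = k (False # drop (p - m) w)"
      using Suc.IH[of "\<lambda>xs. k (False # xs)"] Suc.prems by auto
    obtain t1 where t1: "dt_queries t1 \<subseteq> {..<p}"
      "\<forall>w \<in> cube p. dt_eval t1 w = k (True # drop (p - m) w)"
      using Suc.IH[of "\<lambda>xs. k (True # xs)"] Suc.prems by auto
    have "drop (p - Suc m) w = w ! (p - Suc m) # drop (p - m) w" if "w \<in> cube p" for w
      using that Suc.prems Cons_nth_drop_Suc[of "p - Suc m" w] by (simp add: cube_def Suc_diff_Suc)
    then show ?case
      using t0 t1 Suc.prems by (intro exI[of _ "Query (p - Suc m) t0 t1"]) auto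
  qed
  from this[of p f] show ?thesis by (auto simp: dt_computes_def)
qed

lemma dt_complexity_attained:
  obtains t where "dt_computes p t f" "dt_depth t = dt_complexity p f"
  using LeastI_ex[of "\<lambda>d. \<exists>t. dt_computes p t f \<and> dt_depth t = d"] ex_dtree[of p f]
  unfolding dt_complexity_def by blast

lemma finite_blocks: "finite (blocks p n)"
  using finite_lists_length_eq[OF finite_lists_length_eq[of "UNIV :: bool set" n], of p]
  by (simp add: blocks_def cube_def conj_commute)

lemma ex_protocol:
  fixes F :: "'a \<Rightarrow> 'b \<Rightarrow> 'z option"
  assumes "finite A" "finite B"
  shows "\<exists>P. protocol_computes A B P F"
proof -
  have bob: "\<exists>P. \<forall>x::'a. \<forall>y \<in> B. run_protocol P x y = k y" for k :: "'b \<Rightarrow> 'z"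
    using \<open>finite B\<close>
  proof (induction B rule: finite_induct)
    case (insert b B)
    then obtain P where "\<forall>x::'a. \<forall>y \<in> B. run_protocol P x y = k y" by blast
    then show ?case by (intro exI[of _ "Bob (\<lambda>y. y = b) P (Output (k b))"]) auto
  qed simp
  have "\<exists>P. \<forall>x \<in> A. \<forall>y \<in> B. run_protocol P x y = the (F x y)"
    using \<open>finite A\<close>
  proof (induction A rule: finite_induct)
    case (insert a A)
    then obtain P where P: "\<forall>x \<in> A. \<forall>y \<in> B. run_protocol P x y = the (F x y)" by blast
    obtain Q where Q: "\<forall>x::'a. \<forall>y \<in> B. run_protocol Q x y = the (F a y)"
      using bob[of "\<lambda>y. the (F a y)"] by blast
    show ?case using P Q by (intro exI[of _ "Alice (\<lambda>x. x = a) P Q"]) auto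
  qed simp
  then show ?thesis by (force simp: protocol_computes_def)
qed

lemma cc_complexity_attained:
  assumes "finite A" "finite B"
  obtains P where "protocol_computes A B P F" "protocol_depth P = cc_complexity A B F"
  using LeastI_ex[of "\<lambda>d. \<exists>P. protocol_computes A B P F \<and> protocol_depth P = d"]
    ex_protocol[OF assms, of F]
  unfolding cc_complexity_def by blast

end

theory Submission
  imports Defs
begin

text \<open>
  A decision tree simulates a protocol while keeping sets \<open>A\<close>, \<open>B\<close> of inputs of the two players, whose
  densities are measured on the set \<open>I\<close> of coordinates not yet queried. \<open>A\<close> is thick if every point of
  \<open>A\<close> has at least \<open>2\<^sup>n\<^sup>-\<^sup>h\<close> extensions in every coordinate of \<open>I\<close>; the hitting property then shows
  that every \<open>w\<close> on \<open>I\<close> is realized by some pair in \<open>A \<times> B\<close>, so a leaf of the protocol leaves no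
  freedom for \<open>f\<close>. Removing points with few extensions never decreases the density minus the boundary
  (\<open>2\<^sup>-\<^sup>h\<close> times the sum of the densities of the projections forgetting one coordinate). Hence, if the
  boundary is at most a quarter of the density, a bit of communication followed by removals costs at
  most a factor 4. Otherwise some coordinate \<open>i\<close> has average degree below \<open>4 |I| 2\<^sup>-\<^sup>h\<close>; it is queried,
  and restricting to a rectangle from the hitting distribution of the answer multiplies the product of
  the densities by at least \<open>5/6 \<cdot> 2\<^sup>h / (4 |I|)\<close>. Densities are at most 1, which bounds the number of
  queries. The last bit of communication is free, and \<open>|I|\<close> drops with each query; both are needed
  to reach the constant 8 for small \<open>h\<close>.
\<close>

section \<open>Projections, slices, densities and boundaries\<close>

lemma finite_cube: "finite (cube n)" and card_cube: "card (cube n) = 2 ^ n"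
  using finite_lists_length_eq[of "UNIV :: bool set" n] card_lists_length_eq[of "UNIV :: bool set" n]
  by (simp_all add: cube_def)

lemma blocks_nth: "x \<in> blocks p n \<Longrightarrow> i < p \<Longrightarrow> x ! i \<in> cube n"
  by (auto simp: blocks_def)

lemma finite_subset_blocks: "A \<subseteq> blocks p n \<Longrightarrow> finite A"
  using finite_blocks finite_subset by blast

text \<open>Points are restricted functions, so that two of them are equal exactly when the
  underlying lists agree on \<open>I\<close>.\<close>

definition proj :: "nat set \<Rightarrow> 'a list set \<Rightarrow> (nat \<Rightarrow> 'a) set" where
  "proj I A = (\<lambda>x. restrict ((!) x) I) ` A"

text \<open>For \<open>i\<close> in \<open>I\<close> this is the fibre of \<open>proj I A\<close>
  over \<open>a\<close> in direction \<open>i\<close>; coordinates outside \<open>I\<close> are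
  unconstrained.\<close>

definition slice :: "nat set \<Rightarrow> nat \<Rightarrow> 'a list set \<Rightarrow> (nat \<Rightarrow> 'a) \<Rightarrow> 'a set" where
  "slice I i A a = (\<lambda>x. x ! i) ` {x \<in> A. restrict ((!) x) (I - {i}) = a}"

definition dens :: "nat \<Rightarrow> nat set \<Rightarrow> 'a list set \<Rightarrow> real" where
  "dens n I A = real (card (proj I A)) / 2 ^ (n * card I)"

text \<open>The \<open>i\<close>-th summand, divided by \<open>2 ^ h\<close>, bounds the density
  lost by deleting all fibres in direction \<open>i\<close> that occupy less than a fraction
  \<open>1 / 2 ^ h\<close> of the cube.\<close>

definition boundary :: "nat \<Rightarrow> nat \<Rightarrow> nat set \<Rightarrow> 'a list set \<Rightarrow> real" where
  "boundary n h I A = (\<Sum>i\<in>I. dens n (I - {i}) A) / 2 ^ h"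

text \<open>The threshold is multiplied out because \<open>h\<close> may exceed \<open>n\<close>.
  The empty set is thick, so nonemptiness always has to be secured separately.\<close>

definition thick :: "nat \<Rightarrow> nat \<Rightarrow> nat set \<Rightarrow> 'a list set \<Rightarrow> bool" where
  "thick n h I A \<longleftrightarrow> (\<forall>i\<in>I. \<forall>a\<in>proj (I - {i}) A. 2 ^ n \<le> 2 ^ h * card (slice I i A a))"

lemma restrict_nth_eq_iff:
  "restrict ((!) x) I = restrict ((!) y) I \<longleftrightarrow> (\<forall>i\<in>I. x ! i = y ! i)"
  by (metis restrict_apply' restrict_ext)

lemma finite_proj: "finite A \<Longrightarrow> finite (proj I A)"
  by (simp add: proj_def)

lemma proj_mono: "A \<subseteq> B \<Longrightarrow> proj I A \<subseteq> proj I B"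
  by (auto simp: proj_def)

lemma dens_nonneg: "0 \<le> dens n I A"
  by (simp add: dens_def)

lemma boundary_nonneg: "0 \<le> boundary n h I A"
  by (simp add: boundary_def dens_nonneg sum_nonneg)

lemma dens_mono:
  assumes "finite B" "A \<subseteq> B"
  shows "dens n I A \<le> dens n I B"
  using card_mono[OF finite_proj[OF assms(1)] proj_mono[OF assms(2)]]
  by (simp add: dens_def divide_right_mono)

lemma boundary_mono:
  assumes "finite B" "A \<subseteq> B"
  shows "boundary n h I A \<le> boundary n h I B"
  unfolding boundary_def by (intro divide_right_mono sum_mono dens_mono assms) simp

lemma dens_pos_iff: "finite A \<Longrightarrow> 0 < dens n I A \<longleftrightarrow> A \<noteq> {}"
  by (simp add: dens_def zero_less_divide_iff card_gt_0_iff proj_def)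

lemma dens_split:
  assumes "finite A"
  shows "dens n I A \<le> dens n I {x \<in> A. P x} + dens n I {x \<in> A. \<not> P x}"
proof -
  have "proj I A \<subseteq> proj I {x \<in> A. P x} \<union> proj I {x \<in> A. \<not> P x}"
    by (auto simp: proj_def)
  then have "card (proj I A) \<le> card (proj I {x \<in> A. P x} \<union> proj I {x \<in> A. \<not> P x})"
    using assms by (intro card_mono) (auto intro: finite_proj)
  also have "\<dots> \<le> card (proj I {x \<in> A. P x}) + card (proj I {x \<in> A. \<not> P x})"
    by (rule card_Un_le)
  finally show ?thesis
    by (simp add: dens_def add_divide_distrib[symmetric] divide_right_mono flip: of_nat_add)
qed

lemma dens_half:
  fixes P :: "'a list \<Rightarrow> bool"
  assumes "finite A"
  obtains c where "dens n I A / 2 \<le> dens n I {x \<in> A. P x = c}"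
  using dens_split[OF assms, of n I P] that[of True] that[of False] by fastforce

lemma restrict_nth_fun_upd:
  "i \<in> I \<Longrightarrow> restrict ((!) x) I = (restrict ((!) x) (I - {i}))(i := x ! i)"
  by (auto simp: fun_eq_iff)

text \<open>A point of \<open>proj I A\<close> is determined by its part on \<open>I - {i}\<close>
  and one of \<open>2 ^ n\<close> values at \<open>i\<close>.\<close>

lemma dens_le_remove:
  assumes A: "A \<subseteq> blocks p n" and I: "I \<subseteq> {..<p}" "i \<in> I"
  shows "dens n I A \<le> dens n (I - {i}) A"
proof -
  have finA: "finite A" using A by (rule finite_subset_blocks)
  have "proj I A \<subseteq> (\<lambda>(a, u). a(i := u)) ` (proj (I - {i}) A \<times> cube n)"
  proof
    fix b assume "b \<in> proj I A"
    then obtain x where x: "x \<in> A" "b = restrict ((!) x) I" by (auto simp: proj_def)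
    have "x ! i \<in> cube n" using x A I by (auto intro: blocks_nth)
    moreover have "b = (restrict ((!) x) (I - {i}))(i := x ! i)"
      using x restrict_nth_fun_upd[OF I(2)] by metis
    ultimately show "b \<in> (\<lambda>(a, u). a(i := u)) ` (proj (I - {i}) A \<times> cube n)"
      using x(1) by (intro image_eqI[of _ _ "(restrict ((!) x) (I - {i}), x ! i)"]) (auto simp: proj_def)
  qed
  then have "card (proj I A) \<le> card (proj (I - {i}) A \<times> cube n)"
    by (rule surj_card_le[rotated]) (simp add: finA finite_proj finite_cube)
  then have "card (proj I A) \<le> card (proj (I - {i}) A) * 2 ^ n"
    by (simp add: card_cartesian_product card_cube)
  then have le: "real (card (proj I A)) \<le> real (card (proj (I - {i}) A)) * 2 ^ n"
    by (metis of_nat_le_iff of_nat_mult of_nat_numeral of_nat_power)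
  have "card I = Suc (card (I - {i}))"
    using I by (metis card.remove finite_lessThan finite_subset)
  then have "(2::real) ^ (n * card I) = 2 ^ n * 2 ^ (n * card (I - {i}))"
    by (simp add: power_add)
  then show ?thesis using le by (simp add: dens_def field_simps)
qed

lemma dens_le_1:
  assumes "A \<subseteq> blocks p n" and "I \<subseteq> {..<p}"
  shows "dens n I A \<le> 1"
proof -
  have finI: "finite I" using assms(2) finite_subset by blast
  have "proj I A \<subseteq> (\<Pi>\<^sub>E i\<in>I. cube n)"
    using assms by (fastforce simp: proj_def intro: blocks_nth)
  then have "card (proj I A) \<le> card (\<Pi>\<^sub>E i\<in>I. cube n)"
    by (rule card_mono[rotated]) (simp add: finI finite_PiE finite_cube)
  then have "card (proj I A) \<le> 2 ^ (n * card I)"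
    by (simp add: card_PiE finI card_cube power_mult)
  then have "real (card (proj I A)) \<le> 2 ^ (n * card I)"
    by (metis of_nat_le_iff of_nat_numeral of_nat_power)
  then show ?thesis by (simp add: dens_def)
qed

section \<open>Pruning to thick sets, light coordinates\<close>

text \<open>As long as some fibre is too small, all points of \<open>A\<close> above its base point
  \<open>a\<close> are deleted. The density loses at most that fibre, and the boundary loses at
  least as much because \<open>a\<close> disappears from the projection to
  \<open>I - {i}\<close>.\<close>

lemma exists_thick_subset:
  assumes "finite A" and "finite I"
  shows "\<exists>A' \<subseteq> A. thick n h I A' \<and>
    dens n I A - boundary n h I A \<le> dens n I A' - boundary n h I A'"
  using assms(1)
proof (induction A rule: finite_psubset_induct)
  case (psubset A)
  show ?case
  proof (cases "thick n h I A")
    case False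
    then obtain i a where i: "i \<in> I" and a: "a \<in> proj (I - {i}) A"
      and light: "2 ^ h * card (slice I i A a) < 2 ^ n"
      by (auto simp: thick_def not_le)
    define A1 where "A1 = {x \<in> A. restrict ((!) x) (I - {i}) \<noteq> a}"
    have sub: "A1 \<subset> A" using a by (auto simp: A1_def proj_def)
    have fin1: "finite A1" using sub psubset.hyps finite_subset by blast
    have finS: "finite (slice I i A a)" using psubset.hyps by (simp add: slice_def)
    have "proj I A \<subseteq> proj I A1 \<union> (\<lambda>u. a(i := u)) ` slice I i A a"
    proof
      fix b assume "b \<in> proj I A"
      then obtain x where x: "x \<in> A" "b = restrict ((!) x) I" by (auto simp: proj_def)
      show "b \<in> proj I A1 \<union> (\<lambda>u. a(i := u)) ` slice I i A a"
      proof (cases "restrict ((!) x) (I - {i}) = a")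
        case True
        then have "b = a(i := x ! i)" using x(2) restrict_nth_fun_upd[OF i] by metis
        then show ?thesis using x(1) True unfolding slice_def by blast
      next
        case False
        then show ?thesis using x by (auto simp: proj_def A1_def)
      qed
    qed
    then have "card (proj I A) \<le> card (proj I A1 \<union> (\<lambda>u. a(i := u)) ` slice I i A a)"
      by (rule card_mono[rotated]) (simp add: fin1 finS finite_proj)
    also have "\<dots> \<le> card (proj I A1) + card (slice I i A a)"
      by (meson add_left_mono card_Un_le card_image_le finS le_trans)
    finally have c1: "real (card (proj I A)) \<le> card (proj I A1) + card (slice I i A a)"
      by linarith
    have "proj (I - {i}) A1 \<subseteq> proj (I - {i}) A - {a}"
      by (auto simp: proj_def A1_def)
    then have "card (proj (I - {i}) A1) \<le> card (proj (I - {i}) A - {a})"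
      by (rule card_mono[rotated]) (simp add: psubset.hyps finite_proj)
    also have "\<dots> < card (proj (I - {i}) A)"
      using a psubset.hyps by (intro psubset_card_mono) (auto intro: finite_proj)
    finally have c2: "real (card (proj (I - {i}) A1)) + 1 \<le> card (proj (I - {i}) A)"
      by linarith
    \<comment> \<open>\<open>e\<close> is the density of a single point on \<open>I - {i}\<close>; a
      fibre that is too small has density at most \<open>e / 2 ^ h\<close> on
      \<open>I\<close>.\<close>
    define e :: real where "e = 1 / 2 ^ (n * card (I - {i}))"
    have cI: "card I = Suc (card (I - {i}))" by (rule card.remove[OF assms(2) i])
    have pw: "(2::real) ^ (n * card I) = 2 ^ n * 2 ^ (n * card (I - {i}))"
      by (simp add: cI power_add)
    have "real (2 ^ h * card (slice I i A a)) \<le> real (2 ^ n)"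
      using light by (metis of_nat_le_iff less_imp_le)
    then have sl: "card (slice I i A a) / 2 ^ (n * card I) \<le> e / 2 ^ h"
      by (simp add: pw e_def field_simps)
    have d1: "dens n I A \<le> dens n I A1 + card (slice I i A a) / 2 ^ (n * card I)"
      using c1 by (simp add: dens_def add_divide_distrib[symmetric] divide_right_mono)
    have d2: "dens n (I - {i}) A1 + e \<le> dens n (I - {i}) A"
      using c2 by (simp add: dens_def e_def add_divide_distrib[symmetric] divide_right_mono)
    \<comment> \<open>Direction \<open>i\<close> loses \<open>e\<close>; the other directions can
      only lose.\<close>
    have "(\<Sum>j\<in>I. dens n (I - {j}) A1) + e \<le> (\<Sum>j\<in>I. dens n (I - {j}) A)"
    proof -
      have "(\<Sum>j\<in>I - {i}. dens n (I - {j}) A1) \<le> (\<Sum>j\<in>I - {i}. dens n (I - {j}) A)"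
        using sub psubset.hyps by (intro sum_mono dens_mono) auto
      then show ?thesis using d2 by (simp add: sum.remove[OF assms(2) i])
    qed
    then have "boundary n h I A1 + e / 2 ^ h \<le> boundary n h I A"
      by (simp add: boundary_def add_divide_distrib[symmetric] divide_right_mono)
    then have "dens n I A - boundary n h I A \<le> dens n I A1 - boundary n h I A1"
      using d1 sl by linarith
    with psubset.IH[OF sub] sub show ?thesis by (meson order_trans psubset_imp_subset)
  qed blast
qed

text \<open>A fibre of \<open>A\<close> in a direction \<open>j\<close> other than \<open>i\<close>
  has a constant value at \<open>i\<close>, so it survives the restriction to \<open>U\<close>
  entirely once one of its points does. Forgetting \<open>i\<close> then only merges fibres.\<close>

lemma thick_restrict:
  assumes "thick n h I A" and "finite A" and "i \<in> I"
  shows "thick n h (I - {i}) {x \<in> A. x ! i \<in> U}"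
  unfolding thick_def
proof (intro ballI)
  let ?A = "{x \<in> A. x ! i \<in> U}"
  fix j a assume j: "j \<in> I - {i}" and "a \<in> proj (I - {i} - {j}) ?A"
  then obtain x where x: "x \<in> A" "x ! i \<in> U" "a = restrict ((!) x) (I - {i} - {j})"
    by (auto simp: proj_def)
  let ?a = "restrict ((!) x) (I - {j})"
  have "slice I j A ?a \<subseteq> slice (I - {i}) j ?A a"
  proof
    fix u assume "u \<in> slice I j A ?a"
    then obtain y where y: "y \<in> A" "u = y ! j" "\<forall>k\<in>I - {j}. y ! k = x ! k"
      by (auto simp: slice_def restrict_nth_eq_iff)
    have "y ! i = x ! i" using y(3) assms(3) j by auto
    then show "u \<in> slice (I - {i}) j ?A a"
      using x y by (auto simp: slice_def restrict_nth_eq_iff)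
  qed
  then have "card (slice I j A ?a) \<le> card (slice (I - {i}) j ?A a)"
    using assms(2) by (intro card_mono) (auto simp: slice_def)
  moreover have "2 ^ n \<le> 2 ^ h * card (slice I j A ?a)"
    using assms(1) j x by (auto simp: thick_def proj_def)
  ultimately show "2 ^ n \<le> 2 ^ h * card (slice (I - {i}) j ?A a)"
    by (meson le_trans mult_le_mono2)
qed

text \<open>Averaging over \<open>I\<close>: if every summand of the boundary were small, their sum
  could not exceed a quarter of the density.\<close>

lemma exists_light_coordinate:
  assumes "finite I" and "dens n I A < 4 * boundary n h I A"
  shows "\<exists>i\<in>I. 2 ^ h * dens n I A \<le> 4 * real (card I) * dens n (I - {i}) A"
proof (rule ccontr)
  assume no: "\<not> ?thesis"
  have lt: "4 * real (card I) * dens n (I - {i}) A \<le> 2 ^ h * dens n I A" if "i \<in> I" for i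
    using no that by fastforce
  have "I \<noteq> {}" using assms dens_nonneg[of n I A] by (auto simp: boundary_def)
  then have pos: "0 < real (card I)" using assms by (simp add: card_gt_0_iff)
  have "(\<Sum>i\<in>I. 4 * real (card I) * dens n (I - {i}) A) \<le> real (card I) * (2 ^ h * dens n I A)"
    using sum_mono[of I, OF lt] by simp
  then have "real (card I) * (4 * (\<Sum>i\<in>I. dens n (I - {i}) A)) \<le> real (card I) * (2 ^ h * dens n I A)"
    by (simp add: sum_distrib_left mult_ac)
  then have "4 * (\<Sum>i\<in>I. dens n (I - {i}) A) \<le> 2 ^ h * dens n I A"
    using pos by simp
  then show False using assms(2) by (simp add: boundary_def field_simps)
qed

text \<open>The better value of the bit keeps half of the density, and pruning costs at most the
  boundary, which is at most a quarter.\<close>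

lemma exists_thick_half:
  fixes P :: "'a list \<Rightarrow> bool"
  assumes "finite A" "finite I" and "4 * boundary n h I A \<le> dens n I A"
  obtains c A' where "A' \<subseteq> {x \<in> A. P x = c}" "thick n h I A'" "dens n I A / 4 \<le> dens n I A'"
proof -
  obtain c where c: "dens n I A / 2 \<le> dens n I {x \<in> A. P x = c}" by (rule dens_half[OF assms(1)])
  have "finite {x \<in> A. P x = c}" using assms(1) by simp
  from exists_thick_subset[OF this assms(2), of n h]
  obtain A' where A': "A' \<subseteq> {x \<in> A. P x = c}" "thick n h I A'"
    "dens n I {x \<in> A. P x = c} - boundary n h I {x \<in> A. P x = c} \<le> dens n I A' - boundary n h I A'"
    by blast
  have "boundary n h I {x \<in> A. P x = c} \<le> boundary n h I A"
    by (rule boundary_mono) (use assms(1) in auto)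
  then have "dens n I A / 4 \<le> dens n I A'"
    using c A'(3) assms(3) boundary_nonneg[of n h I A'] by linarith
  with A' that show thesis by blast
qed

lemma slice_subset_cube:
  assumes "A \<subseteq> blocks p n" "i < p"
  shows "slice I i A a \<subseteq> cube n"
  using assms by (auto simp: slice_def intro: blocks_nth)

section \<open>Answered queries and restricted protocols\<close>

text \<open>The simulation invariant: \<open>J\<close> holds the coordinates queried so far and
  \<open>b\<close> the answers received.\<close>

definition fixes_bits ::
  "(bool list \<Rightarrow> bool list \<Rightarrow> bool option) \<Rightarrow> nat set \<Rightarrow> (nat \<Rightarrow> bool) \<Rightarrow>
   bool list list set \<Rightarrow> bool list list set \<Rightarrow> bool" where
  "fixes_bits g J b A B \<longleftrightarrow> (\<forall>x\<in>A. \<forall>y\<in>B. \<forall>j\<in>J. g (x ! j) (y ! j) = Some (b j))"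

lemma fixes_bits_mono:
  "fixes_bits g J b A B \<Longrightarrow> A' \<subseteq> A \<Longrightarrow> B' \<subseteq> B \<Longrightarrow> fixes_bits g J b A' B'"
  by (auto simp: fixes_bits_def)

lemma protocol_computes_mono:
  "protocol_computes A B P F \<Longrightarrow> A' \<subseteq> A \<Longrightarrow> B' \<subseteq> B \<Longrightarrow> protocol_computes A' B' P F"
  by (auto simp: protocol_computes_def)

lemma protocol_computes_Alice:
  "protocol_computes A B (Alice a P0 P1) F \<Longrightarrow>
   protocol_computes {x \<in> A. a x = c} B (if c then P1 else P0) F"
  by (auto simp: protocol_computes_def)

lemma protocol_computes_Bob:
  "protocol_computes A B (Bob b P0 P1) F \<Longrightarrow>
   protocol_computes A {y \<in> B. b y = c} (if c then P1 else P0) F"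
  unfolding protocol_computes_def by (cases c) (simp_all, metis+)

lemma block_compose_eq:
  assumes "w \<in> cube p" "\<And>i. i < p \<Longrightarrow> g (x ! i) (y ! i) = Some (w ! i)"
  shows "block_compose f g p x y = Some (f w)"
proof -
  have "map (\<lambda>i. the (g (x ! i) (y ! i))) [0..<p] = map ((!) w) [0..<length w]"
    using assms by (auto simp: cube_def)
  then show ?thesis using assms by (simp add: block_compose_def map_nth)
qed

section \<open>Consequences of the hitting property\<close>

locale hitting_gadget =
  fixes n h :: nat and \<delta> :: real and g :: "bool list \<Rightarrow> bool list \<Rightarrow> bool option"
  assumes hitting: "has_hitting_monochromatic_distributions n \<delta> h g"
    and \<delta>_less: "\<delta> < 1 / 6"
begin

text \<open>The form used below: largeness is stated as in \<open>thick\<close>, and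
  \<open>1 - \<delta>\<close> is replaced by \<open>5 / 6\<close>.\<close>

lemma hitting_distribution:
  obtains \<sigma> where
    "\<And>R. R \<in> set_pmf \<sigma> \<Longrightarrow> \<exists>U V. R = U \<times> V \<and> (\<forall>u\<in>U. \<forall>v\<in>V. g u v = Some c)"
    "\<And>X Y. X \<subseteq> cube n \<Longrightarrow> Y \<subseteq> cube n \<Longrightarrow> 2 ^ n \<le> 2 ^ h * card X \<Longrightarrow> 2 ^ n \<le> 2 ^ h * card Y \<Longrightarrow>
       5 / 6 \<le> measure_pmf.prob \<sigma> {R. R \<inter> (X \<times> Y) \<noteq> {}}"
proof -
  obtain \<sigma> where h: "hitting_rectangle_distribution n \<delta> h \<sigma>"
    and m: "\<forall>R \<in> set_pmf \<sigma>. monochromatic g c R"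
    using hitting unfolding has_hitting_monochromatic_distributions_def by (cases c) auto
  show thesis
  proof (rule that[of \<sigma>])
    show "\<exists>U V. R = U \<times> V \<and> (\<forall>u\<in>U. \<forall>v\<in>V. g u v = Some c)" if "R \<in> set_pmf \<sigma>" for R
      using that h m
      by (fastforce simp: hitting_rectangle_distribution_def rectangle_def monochromatic_def)
    have powr: "2 powr - real h \<le> real (card X) / 2 ^ n" if "2 ^ n \<le> 2 ^ h * card X" for X :: "bool list set"
    proof -
      have "real (2 ^ n) \<le> real (2 ^ h * card X)" using that of_nat_le_iff by blast
      then show ?thesis by (simp add: powr_minus powr_realpow field_simps)
    qed
    show "5 / 6 \<le> measure_pmf.prob \<sigma> {R. R \<inter> (X \<times> Y) \<noteq> {}}"
      if "X \<subseteq> cube n" "Y \<subseteq> cube n" "2 ^ n \<le> 2 ^ h * card X" "2 ^ n \<le> 2 ^ h * card Y" for X Y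
    proof -
      have "1 - \<delta> \<le> measure_pmf.prob \<sigma> {R. R \<inter> (X \<times> Y) \<noteq> {}}"
        using h that(1,2) powr[OF that(3)] powr[OF that(4)]
        unfolding hitting_rectangle_distribution_def by blast
      then show ?thesis using \<delta>_less by linarith
    qed
  qed
qed

text \<open>By thickness, a random rectangle meets the product of the slices over any fixed pair of
  base points with probability at least \<open>5 / 6\<close>. By linearity of expectation some
  rectangle does so for \<open>5 / 6\<close> of all pairs, and these pairs survive the restriction
  to it.\<close>

lemma exists_hitting_rectangle:
  assumes A: "A \<subseteq> blocks p n" "thick n h I A" and B: "B \<subseteq> blocks p n" "thick n h I B"
    and I: "I \<subseteq> {..<p}" "i \<in> I"
  obtains U V where "\<And>u v. u \<in> U \<Longrightarrow> v \<in> V \<Longrightarrow> g u v = Some c"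
    "5 / 6 * (dens n (I - {i}) A * dens n (I - {i}) B)
       \<le> dens n (I - {i}) {x \<in> A. x ! i \<in> U} * dens n (I - {i}) {y \<in> B. y ! i \<in> V}"
proof -
  define PA PB where "PA = proj (I - {i}) A" and "PB = proj (I - {i}) B"
  have fin: "finite A" "finite B" using A B finite_subset_blocks by blast+
  then have finP: "finite PA" "finite PB" by (simp_all add: PA_def PB_def finite_proj)
  obtain \<sigma> where mono: "\<And>R. R \<in> set_pmf \<sigma> \<Longrightarrow> \<exists>U V. R = U \<times> V \<and> (\<forall>u\<in>U. \<forall>v\<in>V. g u v = Some c)"
    and hit: "\<And>X Y. X \<subseteq> cube n \<Longrightarrow> Y \<subseteq> cube n \<Longrightarrow> 2 ^ n \<le> 2 ^ h * card X \<Longrightarrow> 2 ^ n \<le> 2 ^ h * card Y \<Longrightarrow>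
       5 / 6 \<le> measure_pmf.prob \<sigma> {R. R \<inter> (X \<times> Y) \<noteq> {}}"
    by (rule hitting_distribution[of c]) blast
  define H where "H = (\<lambda>(a, b). {R. R \<inter> (slice I i A a \<times> slice I i B b) \<noteq> {}})"
  \<comment> \<open>\<open>N R\<close> counts the pairs of base points whose product of slices meets
    \<open>R\<close>.\<close>
  define N where "N = (\<lambda>R. \<Sum>q\<in>PA \<times> PB. indicator (H q) R :: real)"
  have ip: "i < p" using I by auto
  have intH: "integrable (measure_pmf \<sigma>) (\<lambda>R. indicator (H q) R :: real)" for q
    by (rule measure_pmf.integrable_const_bound[where B = 1]) (auto simp: indicator_def)
  have intN: "integrable (measure_pmf \<sigma>) N"
    unfolding N_def by (intro Bochner_Integration.integrable_sum intH)
  have "5 / 6 \<le> measure_pmf.prob \<sigma> (H q)" if q0: "q \<in> PA \<times> PB" for q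
  proof -
    obtain a b where q: "q = (a, b)" "a \<in> PA" "b \<in> PB" using q0 by auto
    have "2 ^ n \<le> 2 ^ h * card (slice I i A a)" "2 ^ n \<le> 2 ^ h * card (slice I i B b)"
      using q A(2) B(2) I(2) by (auto simp: thick_def PA_def PB_def)
    then show ?thesis
      using hit[OF slice_subset_cube[OF A(1) ip] slice_subset_cube[OF B(1) ip]] q by (simp add: H_def)
  qed
  then have "5 / 6 * real (card (PA \<times> PB)) \<le> (\<Sum>q\<in>PA \<times> PB. measure_pmf.prob \<sigma> (H q))"
    using sum_mono[of "PA \<times> PB" "\<lambda>_. 5 / 6" "\<lambda>q. measure_pmf.prob \<sigma> (H q)"] by (simp add: mult.commute)
  also have "\<dots> = measure_pmf.expectation \<sigma> N"
    unfolding N_def by (subst Bochner_Integration.integral_sum) (simp_all add: intH)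
  finally have E: "5 / 6 * real (card (PA \<times> PB)) \<le> measure_pmf.expectation \<sigma> N" .
  \<comment> \<open>The rectangle must lie in the support, since only there is it known to be
    monochromatic.\<close>
  have "\<exists>R\<in>set_pmf \<sigma>. 5 / 6 * real (card (PA \<times> PB)) \<le> N R"
  proof (rule ccontr)
    assume "\<not> ?thesis"
    then have "AE R in measure_pmf \<sigma>. N R < 5 / 6 * real (card (PA \<times> PB))"
      by (auto simp: AE_measure_pmf_iff)
    then have "measure_pmf.expectation \<sigma> N < 5 / 6 * real (card (PA \<times> PB))"
      by (rule measure_pmf.expectation_less[OF intN])
    with E show False by simp
  qed
  then obtain R where R: "R \<in> set_pmf \<sigma>" "5 / 6 * real (card (PA \<times> PB)) \<le> N R" by blast
  obtain U V where UV: "R = U \<times> V" "\<forall>u\<in>U. \<forall>v\<in>V. g u v = Some c" using mono[OF R(1)] by blast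
  define QA QB where "QA = proj (I - {i}) {x \<in> A. x ! i \<in> U}" and "QB = proj (I - {i}) {y \<in> B. y ! i \<in> V}"
  have "N R = real (card {q \<in> PA \<times> PB. R \<in> H q})"
    unfolding N_def indicator_def of_bool_def using finP
    by (subst sum.inter_filter[symmetric]) simp_all
  also have "\<dots> \<le> real (card (QA \<times> QB))"
  proof -
    \<comment> \<open>A common point of \<open>U \<times> V\<close> and the slices over
      \<open>a\<close> and \<open>b\<close> yields members of \<open>A\<close> and \<open>B\<close>
      above \<open>a\<close> and \<open>b\<close> whose \<open>i\<close>-th blocks lie in
      \<open>U\<close> and \<open>V\<close>.\<close>
    have "{q \<in> PA \<times> PB. R \<in> H q} \<subseteq> QA \<times> QB"
      by (auto simp: H_def UV slice_def QA_def QB_def proj_def)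
    then show ?thesis
      using fin by (intro of_nat_mono card_mono) (auto simp: QA_def QB_def finite_proj)
  qed
  finally have "5 / 6 * real (card (PA \<times> PB)) \<le> real (card (QA \<times> QB))" using R(2) by linarith
  then have "5 / 6 * (real (card PA) * real (card PB)) \<le> real (card QA) * real (card QB)"
    by (simp add: card_cartesian_product)
  from divide_right_mono[OF this, of "2 ^ (n * card (I - {i})) * 2 ^ (n * card (I - {i}))"]
  have "5 / 6 * (dens n (I - {i}) A * dens n (I - {i}) B)
       \<le> dens n (I - {i}) {x \<in> A. x ! i \<in> U} * dens n (I - {i}) {y \<in> B. y ! i \<in> V}"
    unfolding dens_def PA_def[symmetric] PB_def[symmetric] QA_def[symmetric] QB_def[symmetric]
    by simp
  with UV(2) show thesis by (intro that[of U V]) auto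
qed

text \<open>Coordinates are fixed one by one: a rectangle of colour \<open>w i\<close> leaves both
  sets nonempty, because the product of the densities stays positive, and thick on the remaining
  coordinates.\<close>

lemma thick_realizes_all:
  assumes "finite I" "I \<subseteq> {..<p}" "A \<subseteq> blocks p n" "B \<subseteq> blocks p n"
    "thick n h I A" "thick n h I B" "A \<noteq> {}" "B \<noteq> {}"
  shows "\<exists>x\<in>A. \<exists>y\<in>B. \<forall>i\<in>I. g (x ! i) (y ! i) = Some (w i)"
  using assms
proof (induction I arbitrary: A B rule: finite_induct)
  case (insert i I)
  have fin: "finite A" "finite B" using insert.prems finite_subset_blocks by blast+
  have I: "insert i I - {i} = I" using insert.hyps by auto
  obtain U V where UV: "\<And>u v. u \<in> U \<Longrightarrow> v \<in> V \<Longrightarrow> g u v = Some (w i)"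
    and le: "5 / 6 * (dens n I A * dens n I B)
       \<le> dens n I {x \<in> A. x ! i \<in> U} * dens n I {y \<in> B. y ! i \<in> V}"
    using exists_hitting_rectangle[OF insert.prems(2,4,3,5,1) insertI1, of "w i"] unfolding I by blast
  have "0 < dens n I A * dens n I B" using insert.prems fin by (simp add: dens_pos_iff)
  then have "0 < dens n I {x \<in> A. x ! i \<in> U} * dens n I {y \<in> B. y ! i \<in> V}" using le by linarith
  then have ne: "{x \<in> A. x ! i \<in> U} \<noteq> {}" "{y \<in> B. y ! i \<in> V} \<noteq> {}"
    using fin dens_pos_iff[of "{x \<in> A. x ! i \<in> U}" n I] dens_pos_iff[of "{y \<in> B. y ! i \<in> V}" n I]
      dens_nonneg[of n I "{x \<in> A. x ! i \<in> U}"] dens_nonneg[of n I "{y \<in> B. y ! i \<in> V}"]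
    by (auto simp: zero_less_mult_iff)
  have "thick n h I {x \<in> A. x ! i \<in> U}" "thick n h I {y \<in> B. y ! i \<in> V}"
    using thick_restrict[of n h "insert i I" _ i] insert.prems fin I by auto
  then have "\<exists>x\<in>{x \<in> A. x ! i \<in> U}. \<exists>y\<in>{y \<in> B. y ! i \<in> V}. \<forall>i\<in>I. g (x ! i) (y ! i) = Some (w i)"
    using insert.prems ne by (intro insert.IH) auto
  then show ?case using UV by auto
qed auto

text \<open>If the boundaries are so small that they stay below the densities even when every remaining
  bit of communication halves a density, no query is needed at all.\<close>

lemma constant_if_small_boundary:
  assumes "I \<subseteq> {..<p}" "A \<subseteq> blocks p n" "B \<subseteq> blocks p n"
    "2 ^ protocol_depth P * boundary n h I A < dens n I A"
    "2 ^ protocol_depth P * boundary n h I B < dens n I B"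
    "fixes_bits g ({..<p} - I) b A B"
    "protocol_computes A B P (block_compose f g p)"
  shows "\<exists>z. \<forall>w\<in>cube p. (\<forall>j\<in>{..<p} - I. w ! j = b j) \<longrightarrow> f w = z"
  using assms
proof (induction P arbitrary: A B)
  case (Output z)
  have finI: "finite I" using Output.prems(1) finite_subset by blast
  have fin: "finite A" "finite B" using Output.prems finite_subset_blocks by blast+
  obtain A' where A': "A' \<subseteq> A" "thick n h I A'"
    "dens n I A - boundary n h I A \<le> dens n I A' - boundary n h I A'"
    using exists_thick_subset[OF fin(1) finI] by blast
  obtain B' where B': "B' \<subseteq> B" "thick n h I B'"
    "dens n I B - boundary n h I B \<le> dens n I B' - boundary n h I B'"
    using exists_thick_subset[OF fin(2) finI] by blast
  \<comment> \<open>At a leaf the factor \<open>2 ^ protocol_depth\<close> is 1, so density minus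
    boundary is positive, and pruning preserves this.\<close>
  have "0 < dens n I A'" "0 < dens n I B'"
    using A'(3) B'(3) Output.prems(4,5) boundary_nonneg[of n h I A'] boundary_nonneg[of n h I B'] by auto
  moreover have "finite A'" "finite B'" using fin A'(1) B'(1) finite_subset by blast+
  ultimately have ne: "A' \<noteq> {}" "B' \<noteq> {}" by (simp_all add: dens_pos_iff)
  have "f w = z" if w: "w \<in> cube p" "\<forall>j\<in>{..<p} - I. w ! j = b j" for w
  proof -
    \<comment> \<open>The bits of \<open>w\<close> on \<open>I\<close> come from thickness, the
      others from the answers already fixed. This pair decodes to \<open>w\<close>, so the leaf
      label must be \<open>f w\<close>.\<close>
    obtain x y where xy: "x \<in> A'" "y \<in> B'" "\<forall>i\<in>I. g (x ! i) (y ! i) = Some (w ! i)"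
      using thick_realizes_all[of I p A' B' "(!) w"] finI Output.prems A' B' ne by (meson order_trans)
    then have "x \<in> A" "y \<in> B" using A' B' by auto
    moreover have "g (x ! i) (y ! i) = Some (w ! i)" if "i < p" for i
      using that xy w(2) Output.prems(6) \<open>x \<in> A\<close> \<open>y \<in> B\<close> by (cases "i \<in> I") (auto simp: fixes_bits_def)
    then have "block_compose f g p x y = Some (f w)" by (intro block_compose_eq w)
    ultimately show ?thesis using Output.prems(7) by (fastforce simp: protocol_computes_def)
  qed
  then show ?case by blast
next
  case (Alice a P0 P1)
  have fin: "finite A" using Alice.prems finite_subset_blocks by blast
  obtain c where c: "dens n I A / 2 \<le> dens n I {x \<in> A. a x = c}" by (rule dens_half[OF fin])
  define P where "P = (if c then P1 else P0)"
  have d: "Suc (protocol_depth P) \<le> protocol_depth (Alice a P0 P1)" by (simp add: P_def)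
  have dA: "2 ^ protocol_depth P * boundary n h I {x \<in> A. a x = c} < dens n I {x \<in> A. a x = c}"
  proof -
    \<comment> \<open>The density may halve, but the power of two drops by a factor of at least 2
      and the boundary does not grow.\<close>
    have "2 * (2 ^ protocol_depth P * boundary n h I {x \<in> A. a x = c}) \<le>
        2 ^ protocol_depth (Alice a P0 P1) * boundary n h I A"
      using mult_mono[OF power_increasing[OF d, of "2::real"] boundary_mono[OF fin, of "{x \<in> A. a x = c}" n h I]]
      by (simp add: boundary_nonneg)
    then show ?thesis using c Alice.prems(4) by linarith
  qed
  have dB: "2 ^ protocol_depth P * boundary n h I B < dens n I B"
  proof -
    have "(2::real) ^ protocol_depth P \<le> 2 ^ protocol_depth (Alice a P0 P1)"
      using d by (intro power_increasing) auto
    then have "2 ^ protocol_depth P * boundary n h I B \<le> 2 ^ protocol_depth (Alice a P0 P1) * boundary n h I B"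
      by (intro mult_right_mono boundary_nonneg)
    then show ?thesis using Alice.prems(5) by linarith
  qed
  have f: "fixes_bits g ({..<p} - I) b {x \<in> A. a x = c} B"
    using Alice.prems(6) by (rule fixes_bits_mono) auto
  note pc = protocol_computes_Alice[OF Alice.prems(7), of c, folded P_def]
  have sub: "{x \<in> A. a x = c} \<subseteq> blocks p n" using Alice.prems(2) by auto
  show ?case
    using Alice.IH(1)[OF Alice.prems(1) sub Alice.prems(3) _ _ f]
      Alice.IH(2)[OF Alice.prems(1) sub Alice.prems(3) _ _ f] dA dB pc
    by (cases c) (simp_all add: P_def)
next
  case (Bob a P0 P1)
  have fin: "finite B" using Bob.prems finite_subset_blocks by blast
  obtain c where c: "dens n I B / 2 \<le> dens n I {x \<in> B. a x = c}" by (rule dens_half[OF fin])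
  define P where "P = (if c then P1 else P0)"
  have d: "Suc (protocol_depth P) \<le> protocol_depth (Bob a P0 P1)" by (simp add: P_def)
  have dB: "2 ^ protocol_depth P * boundary n h I {x \<in> B. a x = c} < dens n I {x \<in> B. a x = c}"
  proof -
    have "2 * (2 ^ protocol_depth P * boundary n h I {x \<in> B. a x = c}) \<le>
        2 ^ protocol_depth (Bob a P0 P1) * boundary n h I B"
      using mult_mono[OF power_increasing[OF d, of "2::real"] boundary_mono[OF fin, of "{x \<in> B. a x = c}" n h I]]
      by (simp add: boundary_nonneg)
    then show ?thesis using c Bob.prems(5) by linarith
  qed
  have dA: "2 ^ protocol_depth P * boundary n h I A < dens n I A"
  proof -
    have "(2::real) ^ protocol_depth P \<le> 2 ^ protocol_depth (Bob a P0 P1)"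
      using d by (intro power_increasing) auto
    then have "2 ^ protocol_depth P * boundary n h I A \<le> 2 ^ protocol_depth (Bob a P0 P1) * boundary n h I A"
      by (intro mult_right_mono boundary_nonneg)
    then show ?thesis using Bob.prems(4) by linarith
  qed
  have f: "fixes_bits g ({..<p} - I) b A {x \<in> B. a x = c}"
    using Bob.prems(6) by (rule fixes_bits_mono) auto
  note pc = protocol_computes_Bob[OF Bob.prems(7), of c, folded P_def]
  have sub: "{x \<in> B. a x = c} \<subseteq> blocks p n" using Bob.prems(3) by auto
  show ?case
    using Bob.IH(1)[OF Bob.prems(1,2) sub _ _ f]
      Bob.IH(2)[OF Bob.prems(1,2) sub _ _ f] dA dB pc
    by (cases c) (simp_all add: P_def)
qed

section \<open>Simulation of a protocol by a decision tree\<close>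

text \<open>The last hypothesis is a budget for fewer than \<open>q\<close> queries. A query of
  \<open>i\<close> multiplies the product of the densities by at least
  \<open>5 / 24 * 2 ^ h / card I\<close>, which pays for one factor of each power or product with
  exponent \<open>q\<close>; each bit but the last costs a factor 4. The subtraction is truncated,
  so depths 0 and 1 count alike. Every step lowers depth or \<open>card I\<close>.\<close>

lemma simulation:
  assumes "I \<subseteq> {..<p}" "A \<subseteq> blocks p n" "B \<subseteq> blocks p n" "thick n h I A" "thick n h I B"
    "fixes_bits g ({..<p} - I) b A B"
    "protocol_computes A B P (block_compose f g p)"
    "4 ^ (protocol_depth P - 1) * (\<Prod>k<q. real (card I - k))
       < (5 / 24 * 2 ^ h) ^ q * (dens n I A * dens n I B)"
  shows "\<exists>t. dt_queries t \<subseteq> I \<and> dt_depth t < q \<and>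
    (\<forall>w\<in>cube p. (\<forall>j\<in>{..<p} - I. w ! j = b j) \<longrightarrow> dt_eval t w = f w)"
  using assms
proof (induction "protocol_depth P + card I" arbitrary: P I A B b q rule: less_induct)
  case less
  note I = less.prems(1) and A = less.prems(2,4) and B = less.prems(3,5)
    and bits = less.prems(6) and comp = less.prems(7) and pot = less.prems(8)
  have finI: "finite I" using I finite_subset by blast
  have fin: "finite A" "finite B" using A B finite_subset_blocks by blast+
  have dd: "0 < (5 / 24 * 2 ^ h) ^ q * (dens n I A * dens n I B)"
    using pot by (rule le_less_trans[rotated]) (simp add: prod_nonneg)
  then have pos: "0 < dens n I A * dens n I B" by (simp add: zero_less_mult_iff)
  then have posA: "0 < dens n I A" and posB: "0 < dens n I B"
    using dens_nonneg[of n I A] dens_nonneg[of n I B] by (auto simp: zero_less_mult_iff)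
  \<comment> \<open>With \<open>q = 0\<close> the budget would force a product of densities above
    1.\<close>
  have "q \<noteq> 0"
  proof
    assume "q = 0"
    then have "4 ^ (protocol_depth P - 1) < dens n I A * dens n I B" using pot by simp
    moreover have "dens n I A * dens n I B \<le> 1"
      using dens_le_1[OF A(1) I] dens_le_1[OF B(1) I] by (simp add: mult_le_one dens_nonneg)
    ultimately show False using one_le_power[of "4::real" "protocol_depth P - 1"] by linarith
  qed
  then obtain q' where q: "q = Suc q'" by (cases q) auto
  consider (query) i where "i \<in> I"
      "2 ^ h * (dens n I A * dens n I B) \<le> 4 * real (card I) * (dens n (I - {i}) A * dens n (I - {i}) B)"
    | (clean) "4 * boundary n h I A \<le> dens n I A" "4 * boundary n h I B \<le> dens n I B"
  proof (cases "dens n I A < 4 * boundary n h I A")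
    case True
    then obtain i where i: "i \<in> I" "2 ^ h * dens n I A \<le> 4 * real (card I) * dens n (I - {i}) A"
      using exists_light_coordinate[OF finI] by blast
    \<comment> \<open>One light side is enough: forgetting \<open>i\<close> does not lower the
      density of the other side.\<close>
    have "2 ^ h * dens n I A * dens n I B \<le> 4 * real (card I) * dens n (I - {i}) A * dens n (I - {i}) B"
      by (rule mult_mono[OF i(2) dens_le_remove[OF B(1) I i(1)]]) (simp_all add: dens_nonneg)
    with i(1) query show ?thesis by (simp add: mult_ac)
  next
    case False
    show ?thesis
    proof (cases "dens n I B < 4 * boundary n h I B")
      case True
      then obtain i where i: "i \<in> I" "2 ^ h * dens n I B \<le> 4 * real (card I) * dens n (I - {i}) B"
        using exists_light_coordinate[OF finI] by blast
      have "2 ^ h * dens n I B * dens n I A \<le> 4 * real (card I) * dens n (I - {i}) B * dens n (I - {i}) A"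
        by (rule mult_mono[OF i(2) dens_le_remove[OF A(1) I i(1)]]) (simp_all add: dens_nonneg)
      with i(1) query show ?thesis by (simp add: mult_ac)
    qed (use False clean in simp)
  qed
  then show ?case
  proof cases
    case query
    have cI: "card I = Suc (card (I - {i}))" by (rule card.remove[OF finI query(1)])
    have less_card: "card (I - {i}) < card I" using cI by linarith
    have "\<exists>t. dt_queries t \<subseteq> I - {i} \<and> dt_depth t < q' \<and>
      (\<forall>w\<in>cube p. (\<forall>j\<in>{..<p} - (I - {i}). w ! j = (b(i := c)) j) \<longrightarrow> dt_eval t w = f w)" for c
    proof -
      obtain U V where UV: "\<And>u v. u \<in> U \<Longrightarrow> v \<in> V \<Longrightarrow> g u v = Some c"
        and le: "5 / 6 * (dens n (I - {i}) A * dens n (I - {i}) B)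
          \<le> dens n (I - {i}) {x \<in> A. x ! i \<in> U} * dens n (I - {i}) {y \<in> B. y ! i \<in> V}"
        by (rule exists_hitting_rectangle[OF A B I query(1), of c]) blast
      let ?A = "{x \<in> A. x ! i \<in> U}" and ?B = "{y \<in> B. y ! i \<in> V}"
      let ?K = "5 / 24 * 2 ^ h :: real"
      let ?L = "4 ^ (protocol_depth P - 1) * (\<Prod>k<q'. real (card (I - {i}) - k))"
      \<comment> \<open>The factor for \<open>k = 0\<close> is split off; shifting the index turns
        the rest into the product for \<open>I - {i}\<close>.\<close>
      have "(\<Prod>k<q. real (card I - k)) = real (card I) * (\<Prod>k<q'. real (card (I - {i}) - k))"
        unfolding q prod.lessThan_Suc_shift by (simp add: cI)
      then have "real (card I) * ?L < ?K ^ q * (dens n I A * dens n I B)"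
        using pot by (simp add: mult_ac)
      also have "\<dots> = ?K ^ q' * (5 / 24 * (2 ^ h * (dens n I A * dens n I B)))"
        by (simp add: q mult_ac)
      also have "\<dots> \<le> ?K ^ q' * (5 / 24 * (4 * real (card I) * (dens n (I - {i}) A * dens n (I - {i}) B)))"
        using query(2) by (intro mult_left_mono) auto
      also have "\<dots> = real (card I) * (?K ^ q' * (5 / 6 * (dens n (I - {i}) A * dens n (I - {i}) B)))"
        by (simp add: mult_ac)
      also have "\<dots> \<le> real (card I) * (?K ^ q' * (dens n (I - {i}) ?A * dens n (I - {i}) ?B))"
        using le by (intro mult_left_mono) auto
      \<comment> \<open>The factor \<open>card I\<close> cancels; it is positive because
        \<open>i\<close> lies in \<open>I\<close>.\<close>
      finally have pot': "?L < ?K ^ q' * (dens n (I - {i}) ?A * dens n (I - {i}) ?B)"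
        using cI by simp
      have "{..<p} - (I - {i}) \<subseteq> insert i ({..<p} - I)" by auto
      then have bits': "fixes_bits g ({..<p} - (I - {i})) (b(i := c)) ?A ?B"
        using bits UV by (fastforce simp: fixes_bits_def)
      show ?thesis
      proof (rule less.hyps[OF _ _ _ _ _ _ bits' _ pot'])
        show "protocol_computes ?A ?B P (block_compose f g p)"
          using comp by (rule protocol_computes_mono) auto
      qed (use I A B less_card thick_restrict[OF A(2) fin(1) query(1)] thick_restrict[OF B(2) fin(2) query(1)] in auto)
    qed
    note ex = this
    obtain t0 where t0: "dt_queries t0 \<subseteq> I - {i}" "dt_depth t0 < q'"
      "\<forall>w\<in>cube p. (\<forall>j\<in>{..<p} - (I - {i}). w ! j = (b(i := False)) j) \<longrightarrow> dt_eval t0 w = f w"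
      using ex by blast
    obtain t1 where t1: "dt_queries t1 \<subseteq> I - {i}" "dt_depth t1 < q'"
      "\<forall>w\<in>cube p. (\<forall>j\<in>{..<p} - (I - {i}). w ! j = (b(i := True)) j) \<longrightarrow> dt_eval t1 w = f w"
      using ex by blast
    show ?thesis
    proof (intro exI[of _ "Query i t0 t1"] conjI ballI impI)
      fix w assume w: "w \<in> cube p" "\<forall>j\<in>{..<p} - I. w ! j = b j"
      \<comment> \<open>Reading bit \<open>i\<close> of \<open>w\<close> selects the subtree whose
        assumed answer agrees with \<open>w\<close>.\<close>
      then have "\<forall>j\<in>{..<p} - (I - {i}). w ! j = (b(i := w ! i)) j" by auto
      then show "dt_eval (Query i t0 t1) w = f w"
        using t0(3) t1(3) w(1) by (cases "w ! i") auto
    qed (use t0 t1 q query in auto)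
  next
    case clean
    show ?thesis
    proof (cases "protocol_depth P \<le> 1")
      case True
      \<comment> \<open>The free last bit: twice the boundary is at most half of the density, so no
        further query is needed.\<close>
      have "2 ^ protocol_depth P \<le> (2::real)"
        using power_increasing[OF True, of "2::real"] by simp
      then have two: "2 ^ protocol_depth P * boundary n h I D \<le> 2 * boundary n h I D" for D :: "bool list list set"
        by (intro mult_right_mono boundary_nonneg)
      have "\<exists>z. \<forall>w\<in>cube p. (\<forall>j\<in>{..<p} - I. w ! j = b j) \<longrightarrow> f w = z"
        using two[of A] two[of B] clean posA posB
        by (intro constant_if_small_boundary[OF I A(1) B(1) _ _ bits comp]) auto
      then obtain z where "\<forall>w\<in>cube p. (\<forall>j\<in>{..<p} - I. w ! j = b j) \<longrightarrow> f w = z" by blast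
      then show ?thesis using q by (intro exI[of _ "DLeaf z"]) auto
    next
      case deep: False
      have step: ?thesis
        if sub: "A' \<subseteq> A" "B' \<subseteq> B" and th: "thick n h I A'" "thick n h I B'"
          and comp': "protocol_computes A' B' P' (block_compose f g p)"
          and depth: "protocol_depth P' < protocol_depth P"
          and le: "dens n I A * dens n I B \<le> 4 * (dens n I A' * dens n I B')" for A' B' P'
      proof (rule less.hyps[OF _ I _ _ th _ comp'])
        let ?K = "5 / 24 * 2 ^ h :: real" and ?R = "\<Prod>k<q. real (card I - k)"
        \<comment> \<open>The depth of \<open>P\<close> is at least 2 here, so truncation does not
          hide the decrease.\<close>
        have "Suc (protocol_depth P' - 1) \<le> protocol_depth P - 1" using depth deep by simp
        from power_increasing[OF this, of "4::real"]
        have "4 * 4 ^ (protocol_depth P' - 1) \<le> (4::real) ^ (protocol_depth P - 1)" by simp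
        then have "4 * 4 ^ (protocol_depth P' - 1) * ?R \<le> 4 ^ (protocol_depth P - 1) * ?R"
          by (rule mult_right_mono) (simp add: prod_nonneg)
        also have "\<dots> < ?K ^ q * (dens n I A * dens n I B)" by (rule pot)
        also have "\<dots> \<le> ?K ^ q * (4 * (dens n I A' * dens n I B'))"
          using le by (intro mult_left_mono) auto
        finally show "4 ^ (protocol_depth P' - 1) * ?R < ?K ^ q * (dens n I A' * dens n I B')"
          by simp
      qed (use sub A(1) B(1) depth fixes_bits_mono[OF bits sub] in auto)
      show ?thesis
      proof (cases P)
        case (Output z)
        then show ?thesis using deep by simp
      next
        case (Alice a P0 P1)
        obtain c A' where A': "A' \<subseteq> {x \<in> A. a x = c}" "thick n h I A'" "dens n I A / 4 \<le> dens n I A'"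
          by (rule exists_thick_half[OF fin(1) finI clean(1)])
        show ?thesis
        proof (rule step[of A' B "if c then P1 else P0"])
          show "protocol_computes A' B (if c then P1 else P0) (block_compose f g p)"
            using protocol_computes_mono[OF protocol_computes_Alice A'(1) order_refl] comp Alice by blast
          show "dens n I A * dens n I B \<le> 4 * (dens n I A' * dens n I B)"
            using mult_right_mono[OF A'(3), of "dens n I B"] posB by simp
        qed (use A' B Alice in auto)
      next
        case (Bob a P0 P1)
        obtain c B' where B': "B' \<subseteq> {y \<in> B. a y = c}" "thick n h I B'" "dens n I B / 4 \<le> dens n I B'"
          by (rule exists_thick_half[OF fin(2) finI clean(2)])
        show ?thesis
        proof (rule step[of A B' "if c then P1 else P0"])
          show "protocol_computes A B' (if c then P1 else P0) (block_compose f g p)"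
            using protocol_computes_mono[OF protocol_computes_Bob order_refl B'(1)] comp Bob by blast
          show "dens n I A * dens n I B \<le> 4 * (dens n I A * dens n I B')"
            using mult_left_mono[OF B'(3), of "dens n I A"] posA by simp
        qed (use A B' Bob in auto)
      qed
    qed
  qed
qed

end

section \<open>The initial sets\<close>

lemma proj_blocks:
  assumes "I \<subseteq> {..<p}"
  shows "proj I (blocks p n) = (\<Pi>\<^sub>E i\<in>I. cube n)"
proof
  show "proj I (blocks p n) \<subseteq> (\<Pi>\<^sub>E i\<in>I. cube n)"
    using assms by (fastforce simp: proj_def intro: blocks_nth)
  show "(\<Pi>\<^sub>E i\<in>I. cube n) \<subseteq> proj I (blocks p n)"
  proof
    fix a assume a: "a \<in> (\<Pi>\<^sub>E i\<in>I. cube n)"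
    \<comment> \<open>Outside \<open>I\<close> any block of length \<open>n\<close> serves as
      padding.\<close>
    let ?x = "map (\<lambda>i. if i \<in> I then a i else replicate n False) [0..<p]"
    have "?x \<in> blocks p n" using a by (auto simp: blocks_def cube_def PiE_def Pi_def)
    moreover have "a = restrict ((!) ?x) I"
      using a assms by (auto simp: fun_eq_iff PiE_def extensional_def restrict_def subset_iff)
    ultimately show "a \<in> proj I (blocks p n)" unfolding proj_def by (intro image_eqI)
  qed
qed

lemma dens_blocks:
  assumes "I \<subseteq> {..<p}"
  shows "dens n I (blocks p n) = 1"
proof -
  have "finite I" using assms finite_subset by blast
  then show ?thesis
    by (simp add: dens_def proj_blocks[OF assms] card_PiE card_cube power_mult)
qed

lemma boundary_blocks: "boundary n h {..<p} (blocks p n) = real p / 2 ^ h"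
proof -
  have "dens n ({..<p} - {i}) (blocks p n) = 1" for i by (rule dens_blocks) auto
  then show ?thesis by (simp add: boundary_def)
qed

text \<open>Overwriting one block by any member of the cube stays within \<open>blocks p n\<close>,
  so every slice contains the full cube.\<close>

lemma thick_blocks: "thick n h {..<p} (blocks p n)"
  unfolding thick_def
proof (intro ballI)
  fix i a assume i: "i \<in> {..<p}" and "a \<in> proj ({..<p} - {i}) (blocks p n)"
  then obtain x where x: "x \<in> blocks p n" "a = restrict ((!) x) ({..<p} - {i})"
    by (auto simp: proj_def)
  have "cube n \<subseteq> slice {..<p} i (blocks p n) a"
  proof
    fix u assume u: "u \<in> cube n"
    have "x[i := u] \<in> blocks p n"
      using x(1) u set_update_subset_insert[of x i u] by (auto simp: blocks_def)
    moreover have "x[i := u] ! i = u" using x(1) i by (auto simp: blocks_def)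
    moreover have "restrict ((!) (x[i := u])) ({..<p} - {i}) = a"
      unfolding x(2) by (rule restrict_ext) simp
    ultimately show "u \<in> slice {..<p} i (blocks p n) a"
      unfolding slice_def by (intro image_eqI[of _ _ "x[i := u]"]) auto
  qed
  then have "card (cube n) \<le> card (slice {..<p} i (blocks p n) a)"
    by (rule card_mono[rotated]) (simp add: slice_def finite_blocks)
  then show "2 ^ n \<le> 2 ^ h * card (slice {..<p} i (blocks p n) a)"
    by (simp add: card_cube) (metis le_trans mult_le_mono1 mult_1 one_le_numeral one_le_power)
qed

section \<open>Arithmetic of the query budget\<close>

text \<open>For small \<open>h\<close> the estimate by \<open>p ^ q\<close> used for \<open>h \<ge> 10\<close> is too weak. Each triple lists \<open>h\<close>, the
  largest \<open>p\<close> with \<open>p\<^sup>2 \<le> 2 ^ h\<close>, and a bound on the depths \<open>C\<close> for which fewer than \<open>p\<close> queries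
  are allowed.\<close>

lemma query_budget_table:
  "list_all (\<lambda>(h, p, m). list_all (\<lambda>C. 24 ^ Suc (8 * C div h) * 4 ^ (C - 1) *
       prod_list (map (\<lambda>k. p - k) [0..<Suc (8 * C div h)]) < (5 * 2 ^ h) ^ Suc (8 * C div h)) [0..<m])
     [(5, 5, 4), (6, 8, 6), (7, 11, 10), (8, 16, 16), (9, 22, 25 :: nat)]"
  by (simp add: upt_rec)

text \<open>The table covers only the largest \<open>p\<close>; a smaller \<open>p'\<close>
  decreases every factor. Multiplying by \<open>24 ^ q\<close> turns the claim into the tabulated
  inequality between natural numbers.\<close>

lemma query_budget_small:
  fixes h p m C :: nat
  assumes "(h, p, m) \<in> set [(5, 5, 4), (6, 8, 6), (7, 11, 10), (8, 16, 16), (9, 22, 25 :: nat)]"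
    and "C < m" and "p' \<le> p" and q: "q = Suc (8 * C div h)"
  shows "4 ^ (C - 1) * (\<Prod>k<q. real (p' - k)) < (5 / 24 * 2 ^ h) ^ q"
proof -
  have "24 ^ q * 4 ^ (C - 1) * prod_list (map (\<lambda>k. p - k) [0..<q]) < (5 * 2 ^ h) ^ q"
    using query_budget_table assms(1,2) unfolding list_all_iff q by fastforce
  then have "24 ^ q * 4 ^ (C - 1) * (\<Prod>k<q. p - k) < (5 * 2 ^ h) ^ q"
    by (simp add: prod.list_conv_set_nth atLeast0LessThan del: upt_Suc)
  then have "real (24 ^ q * 4 ^ (C - 1) * (\<Prod>k<q. p - k)) < real ((5 * 2 ^ h) ^ q)"
    by (simp only: of_nat_less_iff)
  then have *: "24 ^ q * (4 ^ (C - 1) * (\<Prod>k<q. real (p - k))) < (5 * 2 ^ h) ^ q"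
    by (simp add: mult_ac)
  have "(\<Prod>k<q. real (p' - k)) \<le> (\<Prod>k<q. real (p - k))"
    using assms(3) by (intro prod_mono) auto
  then have "24 ^ q * (4 ^ (C - 1) * (\<Prod>k<q. real (p' - k))) \<le>
      24 ^ q * (4 ^ (C - 1) * (\<Prod>k<q. real (p - k)))"
    by (intro mult_left_mono) auto
  also have "\<dots> < (5 * 2 ^ h) ^ q" by (rule *)
  also have "\<dots> = 24 ^ q * (5 / 24 * 2 ^ h) ^ q"
    by (subst power_mult_distrib[symmetric]) simp
  finally show ?thesis by simp
qed

text \<open>The power of 4 is below \<open>(2 powr (h / 4)) ^ q\<close> and the product is at most
  \<open>(2 powr (h / 2)) ^ q\<close>. What remains is \<open>24 / 5 \<le> 2 powr (h / 4)\<close>,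
  which holds from \<open>h = 10\<close> on and just fails for \<open>h = 9\<close>.\<close>

lemma query_budget_large:
  fixes h p C :: nat
  assumes "10 \<le> h" and p: "real p \<le> 2 powr (real h / 2)" and q: "q = Suc (8 * C div h)"
  shows "4 ^ (C - 1) * (\<Prod>k<q. real (p - k)) < (5 / 24 * 2 ^ h) ^ q"
proof -
  \<comment> \<open>The successor in \<open>q\<close> rounds the quotient up strictly.\<close>
  have "8 * C < h * q"
    using assms(1) dividend_less_times_div[of h "8 * C"] by (simp add: q)
  then have "real (8 * C) < real (h * q)" by (simp only: of_nat_less_iff)
  then have less: "2 * real C < real h / 4 * real q" by simp
  have "(4::real) ^ (C - 1) \<le> 4 ^ C" by (intro power_increasing) auto
  also have "\<dots> = 2 powr (2 * real C)"
    using powr_powr[of 2 2 "real C"] by (simp add: powr_realpow)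
  also have "\<dots> < 2 powr (real h / 4 * real q)" using less by simp
  also have "\<dots> = (2 powr (real h / 4)) ^ q"
    using powr_powr[of 2 "real h / 4" "real q"] by (simp add: powr_realpow)
  finally have c: "4 ^ (C - 1) < (2 powr (real h / 4)) ^ q" .
  have "(\<Prod>k<q. real (p - k)) \<le> (\<Prod>k<q. 2 powr (real h / 2))"
    using p by (intro prod_mono) auto
  then have "(\<Prod>k<q. real (p - k)) \<le> (2 powr (real h / 2)) ^ q" by simp
  then have "4 ^ (C - 1) * (\<Prod>k<q. real (p - k)) \<le> 4 ^ (C - 1) * (2 powr (real h / 2)) ^ q"
    by (intro mult_left_mono) auto
  also have "\<dots> < (2 powr (real h / 4)) ^ q * (2 powr (real h / 2)) ^ q"
    using c by (intro mult_strict_right_mono) auto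
  also have "\<dots> = (2 powr (real h / 4) * 2 powr (real h / 2)) ^ q" by (simp add: power_mult_distrib)
  also have "\<dots> \<le> (5 / 24 * 2 ^ h) ^ q"
  proof (rule power_mono)
    have "24 / 5 \<le> sqrt 32" by (rule real_le_rsqrt) (simp add: power2_eq_square)
    also have "\<dots> = 2 powr (5 / 2)"
    proof -
      have "2 powr (5 / 2) = (2 powr 5) powr (1 / 2 :: real)" by (simp only: powr_powr) simp
      then show ?thesis by (simp add: powr_half_sqrt)
    qed
    also have "\<dots> \<le> 2 powr (real h / 4)" using assms(1) by simp
    finally have "1 \<le> 5 / 24 * 2 powr (real h / 4)" by simp
    then have "2 powr (real h / 4) * 2 powr (real h / 2) * 1 \<le>
        2 powr (real h / 4) * 2 powr (real h / 2) * (5 / 24 * 2 powr (real h / 4))"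
      by (intro mult_left_mono) auto
    also have "\<dots> = 5 / 24 * 2 powr (real h / 4 + real h / 2 + real h / 4)"
      by (simp only: powr_add mult_ac)
    also have "\<dots> = 5 / 24 * 2 ^ h" by (simp add: powr_realpow)
    finally show "2 powr (real h / 4) * 2 powr (real h / 2) \<le> 5 / 24 * 2 ^ h" by simp
  qed simp
  finally show ?thesis .
qed

text \<open>If \<open>p < q\<close>, the product vanishes. Otherwise \<open>8 * C < h * p\<close>,
  which together with \<open>p\<le>2 powr (h / 2)\<close> leaves finitely many cases below
  \<open>h = 10\<close>. For \<open>h\<close> up to 4 these contradict
  \<open>2 ^ h \<le> 2 ^ C * p\<close>; the others are in the table.\<close>

lemma query_budget:
  fixes h p C :: nat
  assumes "1 \<le> h" and p: "real p \<le> 2 powr (real h / 2)" and C: "2 ^ h \<le> 2 ^ C * p"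
    and q: "q = Suc (8 * C div h)"
  shows "4 ^ (C - 1) * (\<Prod>k<q. real (p - k)) < (5 / 24 * 2 ^ h) ^ q"
proof (cases "p < q \<or> 10 \<le> h")
  case True
  moreover have ?thesis if "p < q"
  proof -
    \<comment> \<open>The factor with \<open>k = p\<close> is zero.\<close>
    have zero: "(\<Prod>k<q. real (p - k)) = 0" using that by (intro prod_zero) auto
    show ?thesis unfolding zero by simp
  qed
  ultimately show ?thesis using query_budget_large[OF _ p q] by blast
next
  case False
  then have "h < 10" and "8 * C div h < p" by (auto simp: q)
  have "(real p)\<^sup>2 \<le> (2 powr (real h / 2))\<^sup>2" using p by (rule power_mono) simp
  also have "\<dots> = 2 ^ h" using powr_powr[of 2 "real h / 2" 2] by (simp add: powr_realpow)
  finally have "real (p\<^sup>2) \<le> real (2 ^ h)" by simp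
  then have sq: "p\<^sup>2 \<le> 2 ^ h" by (simp only: of_nat_le_iff)
  \<comment> \<open>Applied below with \<open>k\<close> the integer part of the square root of
    \<open>2 ^ h\<close>.\<close>
  have bound: "p \<le> k" if "2 ^ h < (Suc k)\<^sup>2" for k
    using sq that power_less_imp_less_base[of p 2 "Suc k"] by simp
  have Cp: "8 * C < h * p"
    using \<open>8 * C div h < p\<close> assms(1) by (simp add: div_less_iff_less_mult mult.commute)
  consider "h = 1" | "h = 2" | "h = 3" | "h = 4" | "h = 5" | "h = 6" | "h = 7" | "h = 8" | "h = 9"
    using assms(1) \<open>h < 10\<close> by linarith
  then show ?thesis
  proof cases
    assume h: "h = 1"
    have "p \<le> 1" by (rule bound) (simp add: h power2_eq_square)
    then have "C = 0" using Cp unfolding h by linarith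
    then show ?thesis using C h \<open>p \<le> 1\<close> by simp
  next
    assume h: "h = 2"
    have "p \<le> 2" by (rule bound) (simp add: h power2_eq_square)
    then have "C = 0" using Cp unfolding h by linarith
    then show ?thesis using C h \<open>p \<le> 2\<close> by simp
  next
    assume h: "h = 3"
    have "p \<le> 2" by (rule bound) (simp add: h power2_eq_square)
    then have "C = 0" using Cp unfolding h by linarith
    then show ?thesis using C h \<open>p \<le> 2\<close> by simp
  next
    assume h: "h = 4"
    have "p \<le> 4" by (rule bound) (simp add: h power2_eq_square)
    then have "C \<le> 1" using Cp unfolding h by linarith
    then have "2 ^ C \<le> (2::nat)" using power_increasing[of C 1 "2::nat"] by simp
    then have "2 ^ C * p \<le> 2 * 4" using \<open>p \<le> 4\<close> by (rule mult_le_mono)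
    then show ?thesis using C h by simp
  next
    assume h: "h = 5"
    have "p \<le> 5" by (rule bound) (simp add: h power2_eq_square)
    moreover from this have "C < 4" using Cp unfolding h by linarith
    ultimately show ?thesis using query_budget_small[of h 5 4 C p q] q h by simp
  next
    assume h: "h = 6"
    have "p \<le> 8" by (rule bound) (simp add: h power2_eq_square)
    moreover from this have "C < 6" using Cp unfolding h by linarith
    ultimately show ?thesis using query_budget_small[of h 8 6 C p q] q h by simp
  next
    assume h: "h = 7"
    have "p \<le> 11" by (rule bound) (simp add: h power2_eq_square)
    moreover from this have "C < 10" using Cp unfolding h by linarith
    ultimately show ?thesis using query_budget_small[of h 11 10 C p q] q h by simp
  next
    assume h: "h = 8"
    have "p \<le> 16" by (rule bound) (simp add: h power2_eq_square)
    moreover from this have "C < 16" using Cp unfolding h by linarith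
    ultimately show ?thesis using query_budget_small[of h 16 16 C p q] q h by simp
  next
    assume h: "h = 9"
    have "p \<le> 22" by (rule bound) (simp add: h power2_eq_square)
    moreover from this have "C < 25" using Cp unfolding h by linarith
    ultimately show ?thesis using query_budget_small[of h 22 25 C p q] q h by simp
  qed
qed

section \<open>Conclusion: tiny initial boundary or simulation\<close>

theorem theorem2:
  fixes n h p :: nat and \<delta> :: real
    and f :: "bool list \<Rightarrow> 'z"
    and g :: "bool list \<Rightarrow> bool list \<Rightarrow> bool option"
  assumes "n \<ge> 1" and "h \<ge> 1" and "p \<ge> 1"
    and "0 \<le> \<delta>" and "\<delta> < 1 / 6"
    and "has_hitting_monochromatic_distributions n \<delta> h g"
    and "real p \<le> 2 powr (real h / 2)"
  shows "real (dt_complexity p f)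
           \<le> 8 / real h * real (cc_complexity (blocks p n) (blocks p n) (block_compose f g p))"
proof -
  interpret hitting_gadget n h \<delta> g using assms by unfold_locales auto
  define C where "C = cc_complexity (blocks p n) (blocks p n) (block_compose f g p)"
  obtain P where comp: "protocol_computes (blocks p n) (blocks p n) P (block_compose f g p)"
    and depth: "protocol_depth P = C"
    unfolding C_def by (rule cc_complexity_attained[OF finite_blocks finite_blocks])
  \<comment> \<open>Nothing has been queried yet, so \<open>b\<close> is arbitrary.\<close>
  have bits: "fixes_bits g ({..<p} - {..<p}) b (blocks p n) (blocks p n)" for b
    by (simp add: fixes_bits_def)
  have "\<exists>t. dt_queries t \<subseteq> {..<p} \<and> dt_depth t < Suc (8 * C div h) \<and> (\<forall>w\<in>cube p. dt_eval t w = f w)"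
  \<comment> \<open>The full set has density 1 and boundary \<open>p / 2 ^ h\<close>. In the first
    case \<open>f\<close> is constant on the cube; the second supplies the lower bound on
    \<open>2 ^ C * p\<close> that the budget needs for small \<open>h\<close>.\<close>
  proof (cases "2 ^ C * p < 2 ^ h")
    case True
    then have "real (2 ^ C * p) < real (2 ^ h)" by (simp only: of_nat_less_iff)
    then have "2 ^ C * boundary n h {..<p} (blocks p n) < dens n {..<p} (blocks p n)"
      by (simp add: boundary_blocks dens_blocks field_simps)
    then have "\<exists>z. \<forall>w\<in>cube p. f w = z"
      using constant_if_small_boundary[OF _ _ _ _ _ bits comp] by (simp add: depth)
    then obtain z where "\<forall>w\<in>cube p. f w = z" by blast
    then show ?thesis by (intro exI[of _ "DLeaf z"]) auto
  next
    case False
    then have "4 ^ (C - 1) * (\<Prod>k<Suc (8 * C div h). real (p - k)) < (5 / 24 * 2 ^ h) ^ Suc (8 * C div h)"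
      using assms by (intro query_budget) auto
    then show ?thesis
      using simulation[OF order_refl order_refl order_refl thick_blocks thick_blocks bits comp,
          of "Suc (8 * C div h)"]
      by (simp add: depth dens_blocks del: prod.lessThan_Suc power_Suc)
  qed
  then obtain t where "dt_computes p t f" "dt_depth t \<le> 8 * C div h"
    by (auto simp: dt_computes_def)
  moreover from this have "dt_complexity p f \<le> dt_depth t"
    unfolding dt_complexity_def by (intro Least_le) blast
  ultimately have "dt_complexity p f \<le> 8 * C div h" by linarith
  then have "real (dt_complexity p f) \<le> real (8 * C div h)" by simp
  also have "\<dots> \<le> real (8 * C) / real h" by (rule of_nat_div_le_of_nat)
  finally show ?thesis by (simp add: C_def)
qed

end
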